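(* Let $\pi_{\mathrm c}$ be the projection onto the contracting plane associated with a unimodular Pisot irreducible substitution on $\{1,2,3\}$. Then for every $n\geq 1$ and every $i_1,\ldots,i_n\in\{1,2,3\}$, the set $\pi_{\mathrm c}(\Sigma_{i_1}\cdots\Sigma_{i_n}(\mathcal U))$ is connected, where $\Sigma_1,\Sigma_2,\Sigma_3$ are the dual substitutions of the Arnoux-Rauzy substitutions and $\mathcal U=[\mathbf 0,1]^\star\cup[\mathbf 0,2]^\star\cup[\mathbf 0,3]^\star$.
   Context: Substitutions. Let $\mathcal A=\{1,2,3\}$ and let $\mathcal A^\star$ be the set of finite words over $\mathcal A$. A substitution is a map $\sigma:\mathcal A^\star\to\mathcal A^\star$ with $\sigma(uv)=\sigma(u)\sigma(v)$ for all words $u,v$ and such that the image of each letter is not the empty word. Its incidence matrix is $\mathbf M_\sigma=(m_{ij})_{1\le i,j\le 3}$, where $m_{ij}$ is the number of occurrences of the letter $i$ in $\sigma(j)$. The substitution is unimodular if $\det \mathbf M_\sigma=\pm1$. The Arnoux-Rauzy substitutions are $\sigma_1: 1\mapsto 1,\ 2\mapsto 21,\ 3\mapsto 31$; $\sigma_2: 1\mapsto 12,\ 2\mapsto 2,\ 3\mapsto 32$; $\sigma_3: 1\mapsto 13,\ 2\mapsto 23,\ 3\mapsto 3$. Unit faces. Let $(\mathbf e_1,\mathbf e_2,\mathbf e_3)$ be the canonical basis of $\mathbb R^3$. For $\mathbf x\in\mathbb Z^3$ and $i\in\{1,2,3\}$, the unit face of type $i$ at $\mathbf x$ is $[\mathbf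 x,i]^\star=\{\mathbf x+\lambda \mathbf e_j+\mu \mathbf e_k:\lambda,\mu\in[0,1]\}$, where $\{i,j,k\}=\{1,2,3\}$. Dual substitution. Let $\mathbf P(w)=(|w|_1,|w|_2,|w|_3)$, where $|w|_i$ is the number of occurrences of $i$ in $w$. For a unimodular substitution $\sigma$, the dual substitution $\mathbf E_1^*(\sigma)$ is defined on unit faces by $$\mathbf E_1^*(\sigma)([\mathbf x,i]^\star)=\bigcup_{j=1,2,3}\ \bigcup_{(p,s)\in\mathcal A^\star\times\mathcal A^\star:\ \sigma(j)=pis}[\mathbf M_\sigma^{-1}(\mathbf x+\mathbf P(s)),j]^\star$$ and extended to unions of unit faces by taking the union of the images of the faces. For $i\in\{1,2,3\}$, $\Sigma_i=\mathbf E_1^*(\sigma_i)$, and $\Sigma_{i_1}\cdots\Sigma_{i_n}$ denotes composition. Projection. A Pisot number is a real algebraic integer greater than $1$ all of whose other conjugates have absolute value less than $1$. A unimodular substitution $\sigma$ is Pisot irreducible if the maximal eigenvalue $\beta$ of $\mathbf M_\sigma$ is a Pisot number and the characteristic polynomial of $\mathbf M_\sigma$ is irreducible (over $\mathbb Q$). For such a $\sigma$, let $\mathbf u_\beta$ be an eigenvector with $\mathbf M_\sigma\mathbf u_\beta=\beta\mathbf u_\beta$ and $\mathbf v_\beta$ an eigenvector with positive entries with ${}^{t}\mathbf M_\sigma\mathbf v_\beta=\beta\mathbf v_\beta$. The contracting plane associated with $\sigma$ is $\mathbb P_{\mathrm c}=\{\mathbf x\in\mathbb R^3:\langle\mathbf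 x,\mathbf v_\beta\rangle=0\}$, and $\pi_{\mathrm c}:\mathbb R^3\to\mathbb P_{\mathrm c}$ is the linear projection onto $\mathbb P_{\mathrm c}$ along $\mathbf u_\beta$. *)

theory Defs
  imports "HOL-Analysis.Analysis" "HOL-Computational_Algebra.Computational_Algebra"
begin

section \<open>Substitutions\<close>

text \<open>
  The alphabet \<open>{1, 2, 3}\<close> is the three-element type \<open>3\<close>, which also indexes the coordinates of
  \<open>real ^ 3\<close>. In this type the numeral \<open>3\<close> equals \<open>0\<close>, and \<open>UNIV = {1, 2, 3}\<close>.
\<close>

type_synonym letter = 3
type_synonym word = "letter list"

definition substitution :: "(word \<Rightarrow> word) \<Rightarrow> bool" where
  "substitution \<sigma> \<longleftrightarrow> (\<forall>u v. \<sigma> (u @ v) = \<sigma> u @ \<sigma> v) \<and> (\<forall>a. \<sigma> [a] \<noteq> [])"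

definition abelianization :: "word \<Rightarrow> int ^ 3" where
  "abelianization w = (\<chi> i. int (count_list w i))"

definition incidence_matrix :: "(word \<Rightarrow> word) \<Rightarrow> int ^ 3 ^ 3" where
  "incidence_matrix \<sigma> = (\<chi> i j. int (count_list (\<sigma> [j]) i))"

definition unimodular :: "(word \<Rightarrow> word) \<Rightarrow> bool" where
  "unimodular \<sigma> \<longleftrightarrow> det (incidence_matrix \<sigma>) = 1 \<or> det (incidence_matrix \<sigma>) = - 1"

definition arnoux_rauzy :: "letter \<Rightarrow> word \<Rightarrow> word" where
  "arnoux_rauzy i w = concat (map (\<lambda>j. if j = i then [i] else [j, i]) w)"

lemma arnoux_rauzy_letters:
  "arnoux_rauzy 1 [1] = [1]"    "arnoux_rauzy 1 [2] = [2, 1]" "arnoux_rauzy 1 [3] = [3, 1]"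
  "arnoux_rauzy 2 [1] = [1, 2]" "arnoux_rauzy 2 [2] = [2]"    "arnoux_rauzy 2 [3] = [3, 2]"
  "arnoux_rauzy 3 [1] = [1, 3]" "arnoux_rauzy 3 [2] = [2, 3]" "arnoux_rauzy 3 [3] = [3]"
  by (simp_all add: arnoux_rauzy_def)

lemma substitution_arnoux_rauzy: "substitution (arnoux_rauzy i)"
  by (simp add: substitution_def arnoux_rauzy_def)

lemma unimodular_arnoux_rauzy: "unimodular (arnoux_rauzy i)"
proof -
  have "i = 1 \<or> i = 2 \<or> i = 3"
    by (rule exhaust_3)
  then show ?thesis
    by (elim disjE) (simp_all add: unimodular_def incidence_matrix_def det_3 arnoux_rauzy_def)
qed


section \<open>Unit faces\<close>

definition unit_face :: "int ^ 3 \<Rightarrow> letter \<Rightarrow> (real ^ 3) set" where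
  "unit_face x i =
     {(\<chi> n. real_of_int (x $ n)) + l *\<^sub>R axis j 1 + m *\<^sub>R axis k 1 | l m j k.
        l \<in> {0..1} \<and> m \<in> {0..1} \<and> {i, j, k} = {1, 2, 3}}"

text \<open>
  A union of unit faces is encoded by the set of the pairs \<open>(x, i)\<close> of the faces it consists of.
  By \<open>unit_face_subset_face_union\<close> below, the union determines this set, so that functions on
  sets of pairs are functions on unions of unit faces.
\<close>

type_synonym face = "(int ^ 3) \<times> letter"

definition face_union :: "face set \<Rightarrow> (real ^ 3) set" where
  "face_union F = (\<Union>(x, i)\<in>F. unit_face x i)"

lemma unit_face_subset_face_union: "unit_face x i \<subseteq> face_union F \<longleftrightarrow> (x, i) \<in> F"
proof
  assume sub: "unit_face x i \<subseteq> face_union F"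
  define c :: "real ^ 3" where
    "c = (\<chi> m. real_of_int (x $ m) + (if m = i then 0 else 1 / 2))"
  obtain j k where jk: "{i, j, k} = {1, 2, 3 :: 3}" "j \<noteq> i" "k \<noteq> i" "j \<noteq> k"
  proof -
    have "i = 1 \<or> i = 2 \<or> i = 3"
      by (rule exhaust_3)
    then show ?thesis
      by (elim disjE) (rule that[of 2 3] that[of 1 3] that[of 1 2]; auto)+
  qed
  have all: "m = i \<or> m = j \<or> m = k" for m
    using jk(1) UNIV_3 by blast
  have "c = (\<chi> m. real_of_int (x $ m)) + (1 / 2) *\<^sub>R axis j 1 + (1 / 2) *\<^sub>R axis k 1"
    unfolding vec_eq_iff
  proof
    fix m
    show "c $ m = ((\<chi> m. real_of_int (x $ m)) + (1 / 2) *\<^sub>R axis j 1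
            + (1 / 2) *\<^sub>R axis k 1) $ m"
      using all[of m] jk(2-4) by (auto simp: c_def axis_def)
  qed
  then have "c \<in> unit_face x i"
    unfolding unit_face_def using jk(1) by fastforce
  with sub obtain y i' where yF: "(y, i') \<in> F" and "c \<in> unit_face y i'"
    by (auto simp: face_union_def)
  then obtain l m j' k' where
    c: "c = (\<chi> m. real_of_int (y $ m)) + l *\<^sub>R axis j' 1 + m *\<^sub>R axis k' 1"
    and lm: "l \<in> {0..1}" "m \<in> {0..1}" and jk': "{i', j', k'} = {1, 2, 3 :: 3}"
    unfolding unit_face_def by blast
  have ne: "j' \<noteq> i'" "k' \<noteq> i'" "j' \<noteq> k'"
  proof -
    have "card {i', j', k'} = 3"
      unfolding jk' by simp
    then show "j' \<noteq> i'" "k' \<noteq> i'" "j' \<noteq> k'"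
      by (auto simp: card_insert_if split: if_splits)
  qed
  have cn: "c $ n = real_of_int (y $ n) + (if n = j' then l else 0) + (if n = k' then m else 0)"
    for n
    using c by (simp add: axis_def)
  have half: "real_of_int a + 1 / 2 \<noteq> real_of_int b" for a b :: int
  proof
    assume "real_of_int a + 1 / 2 = real_of_int b"
    then have "real_of_int (2 * a + 1) = real_of_int (2 * b)"
      by simp
    then have "2 * a + 1 = 2 * b"
      by (simp only: of_int_eq_iff)
    then show False
      by presburger
  qed
  have "c $ i' = real_of_int (y $ i')"
    using ne by (simp add: cn)
  with half[of "x $ i'" "y $ i'"] have i': "i' = i"
    by (auto simp: c_def split: if_splits)
  have "x $ n = y $ n" for n
  proof (cases "n = i")
    case True
    then show ?thesis
      using cn[of n] ne i' by (simp add: c_def)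
  next
    case False
    then have "real_of_int (y $ n) \<le> x $ n + 1 / 2" "x $ n + 1 / 2 \<le> real_of_int (y $ n) + 1"
      using cn[of n] lm ne(3) by (auto simp: c_def split: if_splits)
    then show ?thesis
      by linarith
  qed
  then show "(x, i) \<in> F"
    using yF i' by (metis vec_eq_iff)
qed (auto simp: face_union_def)


section \<open>Dual substitutions\<close>

text \<open>
  For unimodular \<open>\<sigma>\<close> the incidence matrix is invertible over the integers, so the inverse can be
  taken there.
\<close>

definition dual_face :: "(word \<Rightarrow> word) \<Rightarrow> face \<Rightarrow> face set" where
  "dual_face \<sigma> = (\<lambda>(x, i).
     {(matrix_inv (incidence_matrix \<sigma>) *v (x + abelianization s), j) | j p s.
        \<sigma> [j] = p @ [i] @ s})"

definition dual_substitution :: "(word \<Rightarrow> word) \<Rightarrow> face set \<Rightarrow> face set" where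
  "dual_substitution \<sigma> F = (\<Union>f\<in>F. dual_face \<sigma> f)"

definition Sigma_AR :: "letter \<Rightarrow> face set \<Rightarrow> face set" where
  "Sigma_AR i = dual_substitution (arnoux_rauzy i)"

definition Sigma_AR_word :: "letter list \<Rightarrow> face set \<Rightarrow> face set" where
  "Sigma_AR_word w = foldr (\<circ>) (map Sigma_AR w) id"

definition unit_faces_at_origin :: "face set" where
  "unit_faces_at_origin = {(0, 1), (0, 2), (0, 3)}"


section \<open>Pisot irreducible substitutions\<close>

definition eigenvector :: "'a::field ^ 'n ^ 'n \<Rightarrow> 'a ^ 'n \<Rightarrow> 'a \<Rightarrow> bool" where
  "eigenvector A v k \<longleftrightarrow> v \<noteq> 0 \<and> A *v v = k *s v"

definition eigenvalue :: "'a::field ^ 'n ^ 'n \<Rightarrow> 'a \<Rightarrow> bool" where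
  "eigenvalue A k \<longleftrightarrow> (\<exists>v. eigenvector A v k)"

definition char_poly :: "'a::comm_ring_1 ^ 'n ^ 'n \<Rightarrow> 'a poly" where
  "char_poly A = det (\<chi> i j. (if i = j then [:0, 1:] else 0) - [:A $ i $ j:])"

text \<open>Maximality is in modulus, among all complex eigenvalues.\<close>

definition maximal_eigenvalue :: "int ^ 'n ^ 'n \<Rightarrow> real \<Rightarrow> bool" where
  "maximal_eigenvalue A \<beta> \<longleftrightarrow>
     eigenvalue (map_matrix real_of_int A) \<beta> \<and>
     (\<forall>z::complex. eigenvalue (map_matrix of_int A) z \<longrightarrow> cmod z \<le> \<beta>)"

definition conjugate_over_rat :: "complex \<Rightarrow> complex \<Rightarrow> bool" where
  "conjugate_over_rat x y \<longleftrightarrow>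
     (\<exists>p::rat poly. irreducible p \<and>
        poly (map_poly of_rat p) x = 0 \<and> poly (map_poly of_rat p) y = 0)"

definition pisot :: "real \<Rightarrow> bool" where
  "pisot \<beta> \<longleftrightarrow> algebraic_int \<beta> \<and> \<beta> > 1 \<and>
     (\<forall>z. conjugate_over_rat (complex_of_real \<beta>) z \<and> z \<noteq> complex_of_real \<beta> \<longrightarrow> cmod z < 1)"

definition pisot_irreducible :: "(word \<Rightarrow> word) \<Rightarrow> bool" where
  "pisot_irreducible \<sigma> \<longleftrightarrow>
     (\<exists>\<beta>. maximal_eigenvalue (incidence_matrix \<sigma>) \<beta> \<and> pisot \<beta>) \<and>
     irreducible (char_poly (map_matrix rat_of_int (incidence_matrix \<sigma>)))"


section \<open>The contracting plane\<close>

definition contracting_plane :: "real ^ 3 \<Rightarrow> (real ^ 3) set" where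
  "contracting_plane v = {x. x \<bullet> v = 0}"

definition linear_projection_onto_along ::
    "('a::real_vector \<Rightarrow> 'a) \<Rightarrow> 'a set \<Rightarrow> 'a \<Rightarrow> bool" where
  "linear_projection_onto_along \<pi> P u \<longleftrightarrow>
     linear \<pi> \<and> range \<pi> = P \<and> (\<forall>x\<in>P. \<pi> x = x) \<and> {x. \<pi> x = 0} = span {u}"

lemma linear_projection_onto_contracting_plane:
  assumes "u \<bullet> v \<noteq> 0"
  shows "linear_projection_onto_along \<pi> (contracting_plane v) u \<longleftrightarrow>
    \<pi> = (\<lambda>x. x - (x \<bullet> v / (u \<bullet> v)) *\<^sub>R u)"
proof
  assume *: "linear_projection_onto_along \<pi> (contracting_plane v) u"
  then have lin: "linear \<pi>" and fixed: "\<And>x. x \<bullet> v = 0 \<Longrightarrow> \<pi> x = x" and "\<pi> u = 0"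
    using span_base[of u "{u}"] by (auto simp: linear_projection_onto_along_def contracting_plane_def)
  show "\<pi> = (\<lambda>x. x - (x \<bullet> v / (u \<bullet> v)) *\<^sub>R u)"
  proof
    fix x
    let ?y = "x - (x \<bullet> v / (u \<bullet> v)) *\<^sub>R u"
    have "\<pi> ?y = ?y"
      using assms by (intro fixed) (simp add: inner_diff_left)
    then show "\<pi> x = ?y"
      using \<open>\<pi> u = 0\<close> by (simp add: linear_diff[OF lin] linear_scale[OF lin])
  qed
next
  assume \<pi>: "\<pi> = (\<lambda>x. x - (x \<bullet> v / (u \<bullet> v)) *\<^sub>R u)"
  have lin: "linear \<pi>"
    unfolding \<pi> by (rule linearI) (simp_all add: inner_add_left algebra_simps add_divide_distrib)
  have plane: "\<pi> x \<bullet> v = 0" for x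
    using assms by (simp add: \<pi> inner_diff_left)
  have fixed: "\<pi> x = x" if "x \<bullet> v = 0" for x
    using that by (simp add: \<pi>)
  have "\<pi> x = 0 \<longleftrightarrow> x \<in> span {u}" for x
  proof
    assume "\<pi> x = 0"
    then have "x = (x \<bullet> v / (u \<bullet> v)) *\<^sub>R u"
      by (simp add: \<pi>)
    then show "x \<in> span {u}"
      by (metis span_base span_scale singletonI)
  next
    assume "x \<in> span {u}"
    then obtain t where "x = t *\<^sub>R u"
      by (auto simp: span_singleton)
    then show "\<pi> x = 0"
      using assms by (simp add: \<pi>)
  qed
  moreover have "range \<pi> = contracting_plane v"
    unfolding contracting_plane_def using plane fixed by (auto simp: image_iff) metis
  ultimately show "linear_projection_onto_along \<pi> (contracting_plane v) u"
    using lin fixed by (auto simp: linear_projection_onto_along_def contracting_plane_def)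
qed

definition contracting_projection :: "(word \<Rightarrow> word) \<Rightarrow> (real ^ 3 \<Rightarrow> real ^ 3) \<Rightarrow> bool" where
  "contracting_projection \<sigma> \<pi> \<longleftrightarrow>
     (\<exists>\<beta> u v. maximal_eigenvalue (incidence_matrix \<sigma>) \<beta> \<and>
        eigenvector (map_matrix real_of_int (incidence_matrix \<sigma>)) u \<beta> \<and>
        eigenvector (transpose (map_matrix real_of_int (incidence_matrix \<sigma>))) v \<beta> \<and>
        (\<forall>i. v $ i > 0) \<and>
        linear_projection_onto_along \<pi> (contracting_plane v) u)"

end

theory Submission
  imports Defs
begin

text \<open>
  The union of the faces of \<open>\<Sigma>\<^sub>w(\<U>)\<close> is connected already in space, and
  \<open>\<pi>\<close>, being linear, is continuous.

  Write \<open>U\<^sub>x\<close> for the three faces at \<open>x\<close>, and \<open>y = M\<^sub>k\<^sup>-\<^sup>1 x\<close>. The map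
  \<open>\<Sigma>\<^sub>k\<close> sends \<open>[x, k]\<close> to \<open>U\<^sub>y\<close> and \<open>[x, i]\<close>, for \<open>i \<noteq> k\<close>, to the single face
  \<open>[y + e\<^sub>k, i]\<close> (\<open>Sigma_AR_face\<close>). Hence, if \<open>k\<close> is the last letter of a word \<open>w k\<close>, the image
  of a face under \<open>\<Sigma>\<^sub>w\<^sub>k\<close> is the image under \<open>\<Sigma>\<^sub>w\<close> of a face or of some \<open>U\<^sub>y\<close>,
  and the image of \<open>U\<^sub>x\<close> is the union of \<open>\<Sigma>\<^sub>w(U\<^sub>y)\<close> and of the two sets
  \<open>\<Sigma>\<^sub>w([y + e\<^sub>k, j])\<close>, \<open>j \<noteq> k\<close>. By induction on the word all these pieces are connected,
  and it remains to see that the last two meet \<open>\<Sigma>\<^sub>w(U\<^sub>y)\<close>, for every \<open>w\<close>.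

  The difficulty is that two faces with a common edge can have disjoint images: the images of
  \<open>[x, j]\<close> and \<open>[x + e\<^sub>i, j]\<close> under \<open>\<Sigma>\<^sub>k\<close>, with \<open>k\<close> the third letter, have only a
  vertex in common, and are disjoint after a second application. Two configurations, however,
  contain a translate of one of them after any \<open>\<Sigma>\<^sub>k\<close>, so that their parts meet forever:
  the faces \<open>[x, j]\<close> and \<open>[x + e\<^sub>i - e\<^sub>j, i]\<close> (\<open>touching_skew\<close>), and the face
  \<open>[x + e\<^sub>i, j]\<close> together with both faces at \<open>x\<close> of type other than \<open>i\<close>
  (\<open>touching_step\<close>). The second one gives what is needed.
\<close>

(* The symbol is kept for components of vectors. *)
no_notation fps_nth (infixl "$" 75)

section \<open>Unit faces as boxes\<close>

lemma letters_eq_iff: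
  fixes i j k :: letter
  shows "{i, j, k} = {1, 2, 3} \<longleftrightarrow> i \<noteq> j \<and> i \<noteq> k \<and> j \<noteq> k"
proof -
  have "{i, j, k} = {1, 2, 3} \<longleftrightarrow> card {i, j, k} = CARD(3)"
    unfolding UNIV_3[symmetric] by (metis card_eq_UNIV_imp_eq_UNIV finite)
  also have "\<dots> \<longleftrightarrow> i \<noteq> j \<and> i \<noteq> k \<and> j \<noteq> k"
    by (auto simp: card_insert_if)
  finally show ?thesis .
qed

lemma unit_face_eq_cbox:
  "unit_face x i = cbox (\<chi> n. real_of_int (x $ n))
     (\<chi> n. real_of_int (x $ n) + (if n = i then 0 else 1))"
    (is "_ = ?box")
proof (intro equalityI subsetI)
  fix z
  assume "z \<in> unit_face x i"
  then obtain l m j k where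
    z: "z = (\<chi> n. real_of_int (x $ n)) + l *\<^sub>R axis j 1 + m *\<^sub>R axis k 1"
    and lm: "l \<in> {0..1}" "m \<in> {0..1}" and ijk: "{i, j, k} = {1, 2, 3}"
    unfolding unit_face_def by blast
  show "z \<in> ?box"
    using lm ijk by (auto simp: z mem_box_cart axis_def letters_eq_iff)
next
  fix z
  assume z: "z \<in> ?box"
  obtain j k where ijk: "{i, j, k} = {1, 2, 3}"
    using exhaust_3[of i] by (metis insert_commute)
  then have ne: "i \<noteq> j" "i \<noteq> k" "j \<noteq> k"
    by (simp_all add: letters_eq_iff)
  have all: "n = i \<or> n = j \<or> n = k" for n
    using ijk UNIV_3 by blast
  have bounds: "real_of_int (x $ n) \<le> z $ n"
    "z $ n \<le> real_of_int (x $ n) + (if n = i then 0 else 1)" for n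
    using z unfolding mem_box_cart vec_lambda_beta by blast+
  have "z = (\<chi> n. real_of_int (x $ n)) + (z $ j - x $ j) *\<^sub>R axis j 1
      + (z $ k - x $ k) *\<^sub>R axis k 1"
    unfolding vec_eq_iff
  proof
    fix n
    show "z $ n = ((\<chi> n. real_of_int (x $ n)) + (z $ j - x $ j) *\<^sub>R axis j 1
      + (z $ k - x $ k) *\<^sub>R axis k 1) $ n"
      using all[of n] ne bounds[of i] by (auto simp: axis_def)
  qed
  moreover have "z $ j - x $ j \<in> {0..1}" "z $ k - x $ k \<in> {0..1}"
    using bounds[of j] bounds[of k] ne by auto
  ultimately show "z \<in> unit_face x i"
    unfolding unit_face_def using ijk by blast
qed

lemma connected_unit_face: "connected (unit_face x i)"
  by (simp add: unit_face_eq_cbox convex_connected)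

lemma lattice_point_in_unit_face:
  "(\<chi> n. real_of_int (z $ n)) \<in> unit_face x i \<longleftrightarrow>
     z $ i = x $ i \<and> (\<forall>n. n \<noteq> i \<longrightarrow> z $ n = x $ n \<or> z $ n = x $ n + 1)"
proof -
  have coord: "real_of_int (x $ n) \<le> real_of_int (z $ n) \<and>
      real_of_int (z $ n) \<le> real_of_int (x $ n) + (if n = i then 0 else 1) \<longleftrightarrow>
      (n = i \<longrightarrow> z $ n = x $ n) \<and> (n \<noteq> i \<longrightarrow> z $ n = x $ n \<or> z $ n = x $ n + 1)" for n
    by (cases "n = i"; simp; linarith)
  show ?thesis
    unfolding unit_face_eq_cbox mem_box_cart vec_lambda_beta coord by blast
qed

lemma face_union_Un: "face_union (F \<union> G) = face_union F \<union> face_union G"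
  by (auto simp: face_union_def)

lemma face_union_mono: "F \<subseteq> G \<Longrightarrow> face_union F \<subseteq> face_union G"
  by (auto simp: face_union_def)

section \<open>The dual Arnoux-Rauzy substitutions\<close>

text \<open>The inverse of the incidence matrix of \<open>arnoux_rauzy k\<close>, as a map.\<close>

definition shear :: "letter \<Rightarrow> int ^ 3 \<Rightarrow> int ^ 3" where
  "shear k x = (\<chi> n. if n = k then x $ k - (\<Sum>l\<in>- {k}. x $ l) else x $ n)"

lemma shear_0: "shear k 0 = 0"
  by (simp add: shear_def vec_eq_iff)

lemma shear_add: "shear k (x + y) = shear k x + shear k y"
  by (simp add: shear_def vec_eq_iff sum.distrib)

lemma shear_diff: "shear k (x - y) = shear k x - shear k y"
  by (simp add: shear_def vec_eq_iff sum_subtractf)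

lemma shear_axis: "shear k (axis j 1) = (if j = k then axis k 1 else axis j 1 - axis k 1)"
proof -
  have "(\<Sum>l\<in>- {k}. axis j (1::int) $ l) = (if j = k then 0 else 1)"
    by (simp add: axis_def)
  then show ?thesis
    by (auto simp: shear_def vec_eq_iff axis_def)
qed

lemma incidence_matrix_arnoux_rauzy_mult:
  "incidence_matrix (arnoux_rauzy k) *v x = (\<chi> n. if n = k then \<Sum>l\<in>UNIV. x $ l else x $ n)"
  using exhaust_3[of k]
  by (elim disjE)
    (auto simp: vec_eq_iff matrix_vector_mult_def incidence_matrix_def arnoux_rauzy_def sum_3
      forall_3)

lemma invertible_incidence_matrix_arnoux_rauzy: "invertible (incidence_matrix (arnoux_rauzy k))"
proof -
  define A :: "int ^ 3 ^ 3" where "A = (\<chi> i j. if i = j then 1 else if i = k then - 1 else 0)"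
  have "incidence_matrix (arnoux_rauzy k) ** A = mat 1 \<and>
      A ** incidence_matrix (arnoux_rauzy k) = mat 1"
    using exhaust_3[of k]
    by (elim disjE)
      (simp_all add: A_def vec_eq_iff matrix_matrix_mult_def mat_def
        incidence_matrix_def arnoux_rauzy_def sum_3 forall_3)
  then show ?thesis
    unfolding invertible_def by blast
qed

lemma matrix_inv_incidence_matrix_arnoux_rauzy:
  "matrix_inv (incidence_matrix (arnoux_rauzy k)) *v x = shear k x"
proof -
  let ?M = "incidence_matrix (arnoux_rauzy k)"
  have "matrix_inv ?M ** ?M = mat 1"
    using someI_ex[OF invertible_incidence_matrix_arnoux_rauzy[unfolded invertible_def]]
    by (simp add: matrix_inv_def)
  moreover have "?M *v shear k x = x"
  proof -
    have "(\<Sum>l\<in>UNIV. shear k x $ l) = x $ k"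
      by (subst sum.remove[of _ k]) (auto simp: shear_def Compl_eq_Diff_UNIV intro!: sum.cong)
    then show ?thesis
      unfolding incidence_matrix_arnoux_rauzy_mult by (simp add: vec_eq_iff shear_def)
  qed
  ultimately show ?thesis
    by (metis matrix_vector_mul_assoc matrix_vector_mul_lid)
qed

lemma abelianization_simps: "abelianization [] = 0" "abelianization [k] = axis k 1"
  by (auto simp: abelianization_def vec_eq_iff axis_def)

lemma arnoux_rauzy_letter: "arnoux_rauzy k [j] = (if j = k then [k] else [j, k])"
  by (simp add: arnoux_rauzy_def)

text \<open>
  The letter \<open>k\<close> is the last letter of \<open>\<sigma>\<^sub>k(j)\<close> for all three \<open>j\<close>, whereas \<open>i \<noteq> k\<close> occurs
  only in \<open>\<sigma>\<^sub>k(i)\<close>, where it is followed by \<open>k\<close>.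
\<close>

lemma dual_face_arnoux_rauzy:
  "dual_face (arnoux_rauzy k) (x, i) =
     (if i = k then {shear k x} \<times> UNIV else {(shear k x + axis k 1, i)})"
proof -
  have occ: "arnoux_rauzy k [j] = p @ [i] @ s \<longleftrightarrow>
      (if i = k then p = (if j = k then [] else [j]) \<and> s = [] else j = i \<and> p = [] \<and> s = [k])"
    for j p s
    by (auto simp: arnoux_rauzy_letter Cons_eq_append_conv)
  show ?thesis
    unfolding dual_face_def prod.case occ matrix_inv_incidence_matrix_arnoux_rauzy
    by (cases "i = k")
      (simp_all add: abelianization_simps shear_0 shear_add shear_axis set_eq_iff)
qed

lemma Sigma_AR_Un: "Sigma_AR k (F \<union> G) = Sigma_AR k F \<union> Sigma_AR k G"
  by (simp add: Sigma_AR_def dual_substitution_def)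

lemma Sigma_AR_face:
  "Sigma_AR k {(x, i)} = (if i = k then {shear k x} \<times> UNIV else {(shear k x + axis k 1, i)})"
  by (simp add: Sigma_AR_def dual_substitution_def dual_face_arnoux_rauzy)

lemma Sigma_AR_faces_at:
  "Sigma_AR k ({x} \<times> L) =
     (if k \<in> L then {shear k x} \<times> UNIV else {}) \<union> {shear k x + axis k 1} \<times> (L - {k})"
proof -
  have "Sigma_AR k ({x} \<times> L) = (\<Union>i\<in>L. dual_face (arnoux_rauzy k) (x, i))"
    unfolding Sigma_AR_def dual_substitution_def by blast
  also have "\<dots> = (\<Union>i\<in>L. if i = k then {shear k x} \<times> UNIV
      else {(shear k x + axis k 1, i)})"
    by (simp only: dual_face_arnoux_rauzy)
  also have "\<dots> = (if k \<in> L then {shear k x} \<times> UNIV else {}) \<union>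
      {shear k x + axis k 1} \<times> (L - {k})"
    by (cases "k \<in> L") (auto split: if_splits)
  finally show ?thesis .
qed

lemma Sigma_AR_word_Nil: "Sigma_AR_word [] F = F"
  by (simp add: Sigma_AR_word_def)

lemma Sigma_AR_word_snoc: "Sigma_AR_word (w @ [k]) F = Sigma_AR_word w (Sigma_AR k F)"
proof -
  have "foldr (\<circ>) fs g = foldr (\<circ>) fs id \<circ> g" for fs and g :: "face set \<Rightarrow> face set"
    by (induction fs) (auto simp: fun_eq_iff)
  from this[of "map Sigma_AR w" "Sigma_AR k"] show ?thesis
    by (simp add: Sigma_AR_word_def)
qed

lemma Sigma_AR_word_Un: "Sigma_AR_word w (F \<union> G) = Sigma_AR_word w F \<union> Sigma_AR_word w G"
  by (induction w arbitrary: F G rule: rev_induct)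
    (simp_all add: Sigma_AR_word_Nil Sigma_AR_word_snoc Sigma_AR_Un)

lemma Sigma_AR_word_mono: "F \<subseteq> G \<Longrightarrow> Sigma_AR_word w F \<subseteq> Sigma_AR_word w G"
  by (metis Sigma_AR_word_Un sup.absorb_iff2)

section \<open>Pieces that keep touching\<close>

definition touching :: "word \<Rightarrow> face set \<Rightarrow> face set \<Rightarrow> bool" where
  "touching w F G \<longleftrightarrow>
     face_union (Sigma_AR_word w F) \<inter> face_union (Sigma_AR_word w G) \<noteq> {}"

lemma touching_snoc: "touching (w @ [k]) F G \<longleftrightarrow> touching w (Sigma_AR k F) (Sigma_AR k G)"
  by (simp add: touching_def Sigma_AR_word_snoc)

lemma touching_mono:
  assumes "touching w F G" and "F \<subseteq> F'" and "G \<subseteq> G'"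
  shows "touching w F' G'"
  using assms(1) face_union_mono[OF Sigma_AR_word_mono[OF assms(2)], of w]
    face_union_mono[OF Sigma_AR_word_mono[OF assms(3)], of w]
  by (auto simp: touching_def)

lemma touching_NilI:
  assumes "(x, i) \<in> F" and "(y, j) \<in> G"
    and "(\<chi> n. real_of_int (z $ n)) \<in> unit_face x i"
    and "(\<chi> n. real_of_int (z $ n)) \<in> unit_face y j"
  shows "touching [] F G"
  using assms by (force simp: touching_def Sigma_AR_word_Nil face_union_def)

text \<open>
  After any \<open>\<Sigma>\<^sub>k\<close> the pair contains a pair of the same kind: \<open>shear k\<close> changes the
  difference \<open>e\<^sub>i - e\<^sub>j\<close> by \<open>e\<^sub>k\<close> if \<open>k = i\<close>, by \<open>- e\<^sub>k\<close> if \<open>k = j\<close> and not at all otherwise, and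
  this is made up for by the additional translation by \<open>e\<^sub>k\<close> of the faces of type other than \<open>k\<close>.
\<close>

lemma touching_skew:
  assumes "i \<noteq> j"
  shows "touching w {(x, j)} {(x + axis i 1 - axis j 1, i)}"
proof (induction w arbitrary: x rule: rev_induct)
  case Nil
  show ?case
    by (rule touching_NilI[unfolded lattice_point_in_unit_face, where z = "x + axis i 1"])
      (use assms in \<open>auto simp: axis_def\<close>)
next
  case (snoc k w)
  let ?y = "shear k x"
  consider "k = i" | "k = j" | "k \<noteq> i" "k \<noteq> j"
    by blast
  then show ?case
  proof cases
    case 1
    then show ?thesis
      unfolding touching_snoc using assms
      by (intro touching_mono[OF snoc[of "?y + axis i 1"]])
        (auto simp: Sigma_AR_face shear_add shear_diff shear_axis algebra_simps)
  next
    case 2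
    then show ?thesis
      unfolding touching_snoc using assms
      by (intro touching_mono[OF snoc[of ?y]])
        (auto simp: Sigma_AR_face shear_add shear_diff shear_axis algebra_simps)
  next
    case 3
    then show ?thesis
      unfolding touching_snoc using assms
      by (intro touching_mono[OF snoc[of "?y + axis k 1"]])
        (auto simp: Sigma_AR_face shear_add shear_diff shear_axis algebra_simps)
  qed
qed

text \<open>
  Both faces on the left are needed: the one that is nearest to \<open>[x + e\<^sub>i, j]\<close> after \<open>\<Sigma>\<^sub>k\<close>
  comes from \<open>[x, j]\<close> if \<open>k = j\<close>, and from the other one if \<open>k\<close> is the third letter. In the first
  case \<open>touching_skew\<close> takes over.
\<close>

lemma touching_step:
  assumes "j \<noteq> i"
  shows "touching w ({x} \<times> - {i}) {(x + axis i 1, j)}"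
proof (induction w arbitrary: x rule: rev_induct)
  case Nil
  show ?case
    by (rule touching_NilI[unfolded lattice_point_in_unit_face, 
        where z = "x + axis i 1" and x = x and i = j])
      (use assms in \<open>auto simp: axis_def\<close>)
next
  case (snoc k w)
  let ?y = "shear k x"
  consider "k = i" | "k = j" | "k \<noteq> i" "k \<noteq> j"
    by blast
  then show ?case
  proof cases
    case 1
    then show ?thesis
      unfolding touching_snoc using assms
      by (intro touching_mono[OF snoc[of "?y + axis i 1"]])
        (auto simp: Sigma_AR_face Sigma_AR_faces_at shear_add shear_axis algebra_simps)
  next
    case 2
    then show ?thesis
      unfolding touching_snoc using assms
      by (intro touching_mono[OF touching_skew[of i j _ ?y]])
        (auto simp: Sigma_AR_face Sigma_AR_faces_at shear_add shear_axis algebra_simps)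
  next
    case 3
    then show ?thesis
      unfolding touching_snoc using assms
      by (intro touching_mono[OF snoc[of ?y]])
        (auto simp: Sigma_AR_face Sigma_AR_faces_at shear_add shear_axis algebra_simps)
  qed
qed

section \<open>Connectedness\<close>

lemma connected_Sigma_AR_word_Un:
  assumes "connected (face_union (Sigma_AR_word w F))"
    and "connected (face_union (Sigma_AR_word w G))" and "touching w F G"
  shows "connected (face_union (Sigma_AR_word w (F \<union> G)))"
  using assms by (simp add: Sigma_AR_word_Un face_union_Un touching_def connected_Un)

text \<open>
  The two claims need each other: \<open>\<Sigma>\<^sub>k\<close> turns a face of type \<open>k\<close> into three faces at a point,
  and three faces at a point into three such faces and two further ones.
\<close>

lemma connected_Sigma_AR_word:
  "connected (face_union (Sigma_AR_word w {(x, i)}))"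
  "connected (face_union (Sigma_AR_word w ({x} \<times> UNIV)))"
proof (induction w arbitrary: x i rule: rev_induct)
  case Nil
  fix x i
  show "connected (face_union (Sigma_AR_word [] {(x, i)}))"
    by (simp add: Sigma_AR_word_Nil face_union_def connected_unit_face)
  have "(\<chi> n. real_of_int (x $ n)) \<in> (\<Inter>i. unit_face x i)"
    by (simp add: lattice_point_in_unit_face)
  then have "connected (\<Union>i. unit_face x i)"
    by (intro connected_Union) (auto simp: connected_unit_face)
  moreover have "face_union ({x} \<times> UNIV) = (\<Union>i. unit_face x i)"
    by (auto simp: face_union_def)
  ultimately show "connected (face_union (Sigma_AR_word [] ({x} \<times> UNIV)))"
    by (simp add: Sigma_AR_word_Nil)
next
  case (snoc k w)
  fix x i
  show "connected (face_union (Sigma_AR_word (w @ [k]) {(x, i)}))"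
    unfolding Sigma_AR_word_snoc Sigma_AR_face using snoc by simp
  let ?y = "shear k x"
  obtain j m where jm: "{k, j, m} = {1, 2, 3 :: letter}"
    using exhaust_3[of k] by (metis insert_commute)
  then have ne: "j \<noteq> k" "m \<noteq> k"
    by (auto simp: letters_eq_iff)
  have "UNIV - {k} = {j, m}"
    using jm ne UNIV_3 by auto
  then have image: "Sigma_AR k ({x} \<times> UNIV) =
      ({?y} \<times> UNIV \<union> {(?y + axis k 1, j)}) \<union> {(?y + axis k 1, m)}"
    unfolding Sigma_AR_faces_at by auto
  have touch: "touching w ({?y} \<times> UNIV) {(?y + axis k 1, l)}" if "l \<noteq> k" for l
    by (rule touching_mono[OF touching_step[OF that]]) auto
  have "touching w ({?y} \<times> UNIV \<union> {(?y + axis k 1, j)}) {(?y + axis k 1, m)}"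
    by (rule touching_mono[OF touch[OF ne(2)]]) auto
  then show "connected (face_union (Sigma_AR_word (w @ [k]) ({x} \<times> UNIV)))"
    unfolding Sigma_AR_word_snoc image
    using snoc touch[OF ne(1)] by (intro connected_Sigma_AR_word_Un) auto
qed

theorem theorem4p2:
  fixes \<sigma> :: "word \<Rightarrow> word" and \<pi> :: "real ^ 3 \<Rightarrow> real ^ 3" and w :: word
  assumes "substitution \<sigma>" and "unimodular \<sigma>" and "pisot_irreducible \<sigma>"
    and "contracting_projection \<sigma> \<pi>"
    and "length w \<ge> 1"
  shows "connected (\<pi> ` face_union (Sigma_AR_word w unit_faces_at_origin))"
proof -
  have "unit_faces_at_origin = {0} \<times> UNIV"
    by (auto simp: unit_faces_at_origin_def UNIV_3)
  then have "connected (face_union (Sigma_AR_word w unit_faces_at_origin))"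
    by (metis connected_Sigma_AR_word(2))
  moreover have "linear \<pi>"
    using assms(4) by (auto simp: contracting_projection_def linear_projection_onto_along_def)
  ultimately show ?thesis
    by (intro connected_continuous_image linear_continuous_on) (simp add: linear_linear)
qed

end
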